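(* Let $K$ be a field, $n\ge 1$ an integer, $D=K[X_1,\ldots,X_n]$ the polynomial ring in $n$ variables over $K$, and $R=R(D)$. Then $R$ is a local ring, with maximal ideal generated by all elements of the form $\frac1f$ with $f\in D$ a nonconstant polynomial.
   Context: For an integral domain $T$, the reciprocal complement $R(T)$ is the subring of the fraction field of $T$ generated by all $1/f$ with $f\in T\setminus\{0\}$. "Local" means having a unique maximal ideal (no Noetherian hypothesis). *)

theory Defs
  imports
    "HOL-Library.Poly_Mapping"
    "HOL-Computational_Algebra.Fraction_Field"
    "HOL-Algebra.Generated_Rings"
    "HOL-Algebra.Algebraic_Closure_Type"
begin

text \<open>
  Polynomials over \<open>'k\<close> in variables indexed by \<open>'n\<close>: finitely supported maps from exponent
  vectors to coefficients, with the convolution product. For \<open>'n\<close> finite with \<open>n\<close> elements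
  this is \<open>K[X\<^sub>1, \<dots>, X\<^sub>n]\<close>. A linear order on \<open>'n\<close> is needed only for the library's
  proof that this is an integral domain; the ring structure does not depend on it.
\<close>

type_synonym ('k, 'n) mpoly = "('n \<Rightarrow>\<^sub>0 nat) \<Rightarrow>\<^sub>0 'k"

definition nonconstant :: "('k::zero, 'n) mpoly \<Rightarrow> bool" where
  "nonconstant f \<longleftrightarrow> (\<nexists>c. f = Poly_Mapping.single 0 c)"

definition reciprocal_complement :: "'a::idom itself \<Rightarrow> 'a fract ring" where
  "reciprocal_complement T =
     ring_of_type_algebra
       \<lparr>carrier := generate_ring ring_of_type_algebra {Fract 1 f | f::'a. f \<noteq> 0}\<rparr>"

locale local_ring = cring R for R (structure) +
  assumes unique_maximal_ideal: "\<exists>!M. maximalideal M R"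

end

theory Submission
  imports Defs "HOL-Computational_Algebra.Polynomial_Factorial"
begin

text \<open>
  Products of reciprocals are reciprocals, and so are their negatives. Hence the elements of
  \<open>R\<close> are exactly the finite sums \<open>1/f\<^sub>1 + \<dots> + 1/f\<^sub>r\<close> with all \<open>f\<^sub>i \<noteq> 0\<close>, and the ideal \<open>m\<close>
  generated by the reciprocals of nonconstant polynomials consists of the sums in which every
  \<open>f\<^sub>i\<close> is nonconstant. Nonzero constants are invertible in \<open>R\<close>, so an element outside \<open>m\<close> is a
  nonzero constant times some \<open>1 + 1/f\<^sub>1 + \<dots> + 1/f\<^sub>r\<close> with the \<open>f\<^sub>i\<close> nonconstant
  (\<open>constant_plus_nonconstant_recip_sum\<close>). Everything thus reduces to showing that such an element
  is nonzero and that its inverse lies in \<open>R\<close>: the first gives \<open>1 \<notin> m\<close>, the second makes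
  every element outside \<open>m\<close> a unit.

  For a finite family \<open>M\<close> of nonconstant polynomials let \<open>c(M) = (\<Prod>f\<in>M. f) (1 + (\<Sum>f\<in>M. 1/f))\<close>.
  This is a polynomial, and all its terms apart from \<open>\<Prod>M\<close> are proper subproducts of \<open>M\<close>. Under a
  monomial order those have strictly smaller leading monomials, so \<open>c(M) \<noteq> 0\<close>
  (\<open>cleared_nonconstant\<close>).

  The inverse of \<open>1 + (\<Sum>f\<in>M. 1/f)\<close> is \<open>\<Prod>M / c(M)\<close>. More generally, \<open>\<Prod>T / c(M)\<close> lies in \<open>R\<close>
  for every subfamily \<open>T\<close> of \<open>M\<close> (\<open>prod_mset_div_cleared_mem\<close>). If \<open>T\<close> is empty this is the
  reciprocal of a nonzero polynomial. Otherwise remove one \<open>x\<close> from both, \<open>T = T' + x\<close> and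
  \<open>M = N + x\<close>. Then \<open>c(M) = x c(N) + \<Prod>N\<close>, and therefore
  \<open>\<Prod>T / c(M) = \<Prod>T' / c(N) - (\<Prod>N / c(N)) (\<Prod>T' / c(M))\<close>,
  where each of the three quotients on the right has a smaller \<open>M\<close> or a smaller \<open>T\<close>.
\<close>

section \<open>Leading monomials\<close>

definition lead :: "('a::linorder \<Rightarrow>\<^sub>0 'b::zero) \<Rightarrow> 'a" where
  "lead f = Max (Poly_Mapping.keys f)"

lemma lead_in_keys: "f \<noteq> 0 \<Longrightarrow> lead f \<in> Poly_Mapping.keys f"
  unfolding lead_def by (intro Max_in) auto

lemma lead_eqI:
  assumes "a \<in> Poly_Mapping.keys f" and "\<And>b. b \<in> Poly_Mapping.keys f \<Longrightarrow> b \<le> a"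
  shows "lead f = a"
  unfolding lead_def using assms by (intro Max_eqI) auto

lemma le_lead: "a \<in> Poly_Mapping.keys f \<Longrightarrow> a \<le> lead f"
  unfolding lead_def by simp

lemma lead_uminus: "lead (- f) = lead (f :: 'a::linorder \<Rightarrow>\<^sub>0 'b::ab_group_add)"
  by (simp add: lead_def)

lemma lead_add_less:
  fixes f g :: "'a::linorder \<Rightarrow>\<^sub>0 'b::comm_monoid_add"
  assumes "f \<noteq> 0" "lead g < lead f"
  shows "f + g \<noteq> 0" "lead (f + g) = lead f"
proof -
  have "lead f \<notin> Poly_Mapping.keys g"
    using assms(2) le_lead[of "lead f" g] by auto
  with lead_in_keys[OF assms(1)] have k: "lead f \<in> Poly_Mapping.keys (f + g)"
    by (simp add: in_keys_iff lookup_add)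
  then show "f + g \<noteq> 0" by auto
  show "lead (f + g) = lead f"
  proof (rule lead_eqI[OF k])
    fix b assume "b \<in> Poly_Mapping.keys (f + g)"
    then consider "b \<in> Poly_Mapping.keys f" | "b \<in> Poly_Mapping.keys g"
      using keys_add[of f g] by blast
    then show "b \<le> lead f"
      using assms(2) by cases (auto dest: le_lead)
  qed
qed

text \<open>
  Each factor is its leading term plus terms with smaller exponents. Since addition is
  strictly monotone, only the product of the two leading terms contributes at the exponent
  \<open>lead f + lead g\<close>.
\<close>
lemma lead_mult:
  fixes f g :: "'a::{ordered_cancel_comm_monoid_add, linorder} \<Rightarrow>\<^sub>0 'b::idom"
  assumes "f \<noteq> 0" "g \<noteq> 0"
  shows "lead (f * g) = lead f + lead g"
proof -
  define f' where "f' = f - Poly_Mapping.single (lead f) (Poly_Mapping.lookup f (lead f))"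
  define g' where "g' = g - Poly_Mapping.single (lead g) (Poly_Mapping.lookup g (lead g))"
  have f': "a < lead f" if "a \<in> Poly_Mapping.keys f'" for a
    using that le_lead[of a f]
    by (cases "a = lead f") (auto simp: f'_def in_keys_iff lookup_minus lookup_single)
  have g': "a < lead g" if "a \<in> Poly_Mapping.keys g'" for a
    using that le_lead[of a g]
    by (cases "a = lead g") (auto simp: g'_def in_keys_iff lookup_minus lookup_single)
  have split: "f * g = Poly_Mapping.single (lead f) (Poly_Mapping.lookup f (lead f)) *
      Poly_Mapping.single (lead g) (Poly_Mapping.lookup g (lead g)) +
      Poly_Mapping.single (lead f) (Poly_Mapping.lookup f (lead f)) * g' + f' * g"
    by (simp add: f'_def g'_def algebra_simps)
  have "lead f + lead g \<notin> Poly_Mapping.keys (f' * g)"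
  proof
    assume "lead f + lead g \<in> Poly_Mapping.keys (f' * g)"
    then obtain a b where "lead f + lead g = a + b" "a \<in> Poly_Mapping.keys f'"
      "b \<in> Poly_Mapping.keys g"
      using keys_mult[of f' g] by blast
    with add_less_le_mono[of a "lead f" b "lead g"] f' le_lead[of b g] show False by simp
  qed
  moreover have "lead f + lead g \<notin> Poly_Mapping.keys
      (Poly_Mapping.single (lead f) (Poly_Mapping.lookup f (lead f)) * g')" (is "_ \<notin> Poly_Mapping.keys (?s * _)")
  proof
    assume "lead f + lead g \<in> Poly_Mapping.keys (?s * g')"
    then obtain a b where "lead f + lead g = a + b" "a \<in> Poly_Mapping.keys ?s"
      "b \<in> Poly_Mapping.keys g'"
      using keys_mult[of ?s g'] by blast
    with g'[of b] show False by (auto split: if_splits)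
  qed
  ultimately have "Poly_Mapping.lookup (f * g) (lead f + lead g) =
      Poly_Mapping.lookup f (lead f) * Poly_Mapping.lookup g (lead g)"
    by (subst split) (simp add: lookup_add mult_single in_keys_iff)
  moreover have "Poly_Mapping.lookup f (lead f) \<noteq> 0" "Poly_Mapping.lookup g (lead g) \<noteq> 0"
    using assms lead_in_keys by (auto simp: in_keys_iff)
  ultimately have k: "lead f + lead g \<in> Poly_Mapping.keys (f * g)"
    by (simp add: in_keys_iff)
  show ?thesis
  proof (rule lead_eqI[OF k])
    fix c assume "c \<in> Poly_Mapping.keys (f * g)"
    then obtain a b where "c = a + b" "a \<in> Poly_Mapping.keys f" "b \<in> Poly_Mapping.keys g"
      using keys_mult[of f g] by blast
    then show "c \<le> lead f + lead g" by (simp add: add_mono le_lead)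
  qed
qed

text \<open>
  Exponent vectors are compared lexicographically. That \<open>0\<close> is the least of them makes this a
  monomial order, and lets the leading monomial detect nonconstant polynomials.
\<close>
lemma zero_le_exponent: "0 \<le> (m :: 'n::linorder \<Rightarrow>\<^sub>0 nat)"
proof (rule ccontr)
  assume "\<not> 0 \<le> m"
  then have "m < 0" by simp
  then show False by transfer (auto simp: less_fun_def)
qed

lemma nonconstant_iff_lead:
  fixes f :: "('k::zero, 'n::linorder) mpoly"
  shows "nonconstant f \<longleftrightarrow> f \<noteq> 0 \<and> 0 < lead f"
proof
  assume n: "nonconstant f"
  then have "f \<noteq> 0" unfolding nonconstant_def by (metis single_zero)
  moreover have "lead f \<noteq> 0"
  proof
    assume "lead f = 0"
    then have "a = 0" if "a \<in> Poly_Mapping.keys f" for a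
      using le_lead[OF that] zero_le_exponent[of a] by simp
    then have "f = Poly_Mapping.single 0 (Poly_Mapping.lookup f 0)"
      by (intro poly_mapping_eqI) (metis in_keys_iff lookup_single_eq lookup_single_not_eq)
    with n show False unfolding nonconstant_def by blast
  qed
  ultimately show "f \<noteq> 0 \<and> 0 < lead f"
    using zero_le_exponent[of "lead f"] by (simp add: order_less_le)
next
  assume *: "f \<noteq> 0 \<and> 0 < lead f"
  show "nonconstant f" unfolding nonconstant_def
  proof
    assume "\<exists>c. f = Poly_Mapping.single 0 c"
    with * lead_in_keys[of f] show False by (auto split: if_splits)
  qed
qed

lemma nonconstant_nonzero: "nonconstant (f :: ('k::zero, 'n::linorder) mpoly) \<Longrightarrow> f \<noteq> 0"
  by (simp add: nonconstant_iff_lead)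

lemma nonconstant_uminus:
  "nonconstant (- f) \<longleftrightarrow> nonconstant (f :: ('k::ab_group_add, 'n::linorder) mpoly)"
  by (simp add: nonconstant_iff_lead lead_uminus)

lemma nonconstant_mult:
  fixes f g :: "('k::idom, 'n::linorder) mpoly"
  assumes "f \<noteq> 0" "nonconstant g"
  shows "nonconstant (f * g)"
  using assms add_nonneg_pos[OF zero_le_exponent[of "lead f"], of "lead g"]
  by (auto simp: nonconstant_iff_lead lead_mult)

section \<open>Inverting one plus a sum of reciprocals\<close>

definition recip_sum :: "'a::field multiset \<Rightarrow> 'a" where
  "recip_sum M = (\<Sum>x\<in>#M. inverse x)"

text \<open>
  The numerator of \<open>1 + recip_sum M\<close> over the common denominator \<open>prod_mset M\<close>: for nonzero
  elements it is the sum of \<open>prod_mset M\<close> and all products of \<open>M\<close> with one factor left out.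
\<close>
definition cleared :: "'a::field multiset \<Rightarrow> 'a" where
  "cleared M = prod_mset M * (1 + recip_sum M)"

lemma cleared_add_mset:
  "x \<noteq> 0 \<Longrightarrow> cleared (add_mset x M) = x * cleared M + prod_mset M"
  by (simp add: cleared_def recip_sum_def algebra_simps)

text \<open>
  The inverse of \<open>1 + recip_sum M\<close> is the case \<open>T = M\<close>. Smaller \<open>T\<close> are included because the
  recursion meets the quotients with one factor missing from the numerator. In the application
  \<open>S\<close> is the reciprocal complement, and the assumption on \<open>cleared N\<close> holds because \<open>cleared N\<close>
  is a nonzero element of the original domain.
\<close>
lemma prod_mset_div_cleared_mem:
  fixes S :: "'a::field set"
  assumes diff: "\<And>x y. x \<in> S \<Longrightarrow> y \<in> S \<Longrightarrow> x - y \<in> S"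
    and mult: "\<And>x y. x \<in> S \<Longrightarrow> y \<in> S \<Longrightarrow> x * y \<in> S"
    and nz: "0 \<notin># M"
    and cl: "\<And>N. N \<subseteq># M \<Longrightarrow> cleared N \<noteq> 0 \<and> inverse (cleared N) \<in> S"
    and "T \<subseteq># M"
  shows "prod_mset T / cleared M \<in> S"
  using nz cl \<open>T \<subseteq># M\<close>
proof (induction "size M" arbitrary: M T rule: less_induct)
  case outer: less
  note nz = outer.prems(1) and cl = outer.prems(2)
  show ?case using outer.prems(3)
  proof (induction T)
    case empty
    show ?case using cl[of M] by (simp add: inverse_eq_divide)
  next
    case (add x T)
    obtain N where M: "M = add_mset x N" and T: "T \<subseteq># N"
      using add.prems by (metis insert_subset_eq_iff mset_subset_eqD multi_member_split
          mset_subset_eq_add_mset_cancel union_single_eq_member)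
    have x: "x \<noteq> 0" and nzN: "0 \<notin># N" using nz M by auto
    have clN: "cleared K \<noteq> 0 \<and> inverse (cleared K) \<in> S" if "K \<subseteq># N" for K
      using cl[of K] that M by (metis subset_mset.order_trans mset_subset_eq_add_right
          add_mset_add_single mset_subset_eq_add_left)
    have "prod_mset T / cleared N \<in> S" "prod_mset N / cleared N \<in> S"
      using outer.hyps[of N] nzN clN T M by auto
    moreover have "prod_mset T / cleared M \<in> S"
      using add.IH T M by (metis add_mset_add_single mset_subset_eq_add_left
          subset_mset.order_trans)
    ultimately have "prod_mset T / cleared N
        - (prod_mset N / cleared N) * (prod_mset T / cleared M) \<in> S"
      by (intro diff mult)
    \<comment> \<open>Solve \<open>cleared M = x * cleared N + prod_mset N\<close> for \<open>x\<close>, then divide by \<open>cleared M\<close>.\<close>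
    moreover have "prod_mset (add_mset x T) / cleared M = prod_mset T / cleared N
        - (prod_mset N / cleared N) * (prod_mset T / cleared M)"
    proof -
      have c: "cleared M = x * cleared N + prod_mset N"
        using cleared_add_mset[OF x] M by simp
      have "cleared N \<noteq> 0" "cleared M \<noteq> 0" using clN[of N] cl[of M] by auto
      moreover from this have "prod_mset T / cleared N
        - (prod_mset N / cleared N) * (prod_mset T / cleared M)
        = prod_mset T * (cleared M - prod_mset N) / (cleared N * cleared M)"
        by (simp add: field_simps)
      ultimately show ?thesis by (simp add: c)
    qed
    ultimately show ?case by simp
  qed
qed

lemma inverse_one_plus_recip_sum_mem:
  fixes S :: "'a::field set"
  assumes "\<And>x y. x \<in> S \<Longrightarrow> y \<in> S \<Longrightarrow> x - y \<in> S"
    and "\<And>x y. x \<in> S \<Longrightarrow> y \<in> S \<Longrightarrow> x * y \<in> S"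
    and nz: "0 \<notin># M"
    and "\<And>N. N \<subseteq># M \<Longrightarrow> cleared N \<noteq> 0 \<and> inverse (cleared N) \<in> S"
  shows "inverse (1 + recip_sum M) \<in> S"
proof -
  have "prod_mset M / cleared M \<in> S"
    using prod_mset_div_cleared_mem[OF assms, of M] by simp
  moreover have "prod_mset M \<noteq> 0" using nz by (simp add: prod_mset_zero_iff)
  moreover have "prod_mset M / (prod_mset M * (1 + recip_sum M)) = inverse (1 + recip_sum M)"
    using nonzero_divide_mult_cancel_left[OF calculation(2), of "1 + recip_sum M"]
    by (simp only: inverse_eq_divide)
  ultimately show ?thesis by (simp only: cleared_def)
qed

section \<open>Sums of reciprocals in a fraction field\<close>

definition recip_sums :: "'a::idom set \<Rightarrow> 'a fract set" where
  "recip_sums A = {recip_sum (image_mset to_fract M) | M. set_mset M \<subseteq> A}"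

lemma recip_sumsI: "set_mset M \<subseteq> A \<Longrightarrow> recip_sum (image_mset to_fract M) \<in> recip_sums A"
  by (auto simp: recip_sums_def)

lemma inverse_to_fract: "inverse (to_fract f) = Fract 1 f"
  by (simp add: to_fract_def)

lemma recip_sums_zero: "0 \<in> recip_sums A"
  using recip_sumsI[of "{#}" A] by (simp add: recip_sum_def)

lemma recip_sums_Fract: "f \<in> A \<Longrightarrow> Fract 1 f \<in> recip_sums A"
  using recip_sumsI[of "{#f#}" A] by (simp add: recip_sum_def inverse_to_fract)

lemma recip_sums_add:
  assumes "x \<in> recip_sums A" "y \<in> recip_sums A"
  shows "x + y \<in> recip_sums A"
proof -
  obtain M N where "x = recip_sum (image_mset to_fract M)" "y = recip_sum (image_mset to_fract N)"
    "set_mset M \<subseteq> A" "set_mset N \<subseteq> A"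
    using assms by (auto simp: recip_sums_def)
  then show ?thesis
    using recip_sumsI[of "M + N" A] by (simp add: recip_sum_def)
qed

lemma recip_sums_induct [consumes 1, case_names zero add]:
  assumes "x \<in> recip_sums A" and "P 0"
    and "\<And>f x. f \<in> A \<Longrightarrow> x \<in> recip_sums A \<Longrightarrow> P x \<Longrightarrow> P (Fract 1 f + x)"
  shows "P x"
proof -
  have "P (recip_sum (image_mset to_fract M))" if "set_mset M \<subseteq> A" for M
    using that
  proof (induction M)
    case empty
    then show ?case using assms(2) by (simp add: recip_sum_def)
  next
    case (add f M)
    then show ?case using assms(3)[of f "recip_sum (image_mset to_fract M)"]
      by (auto simp: recip_sum_def inverse_to_fract recip_sums_def)
  qed
  with assms(1) show ?thesis by (auto simp: recip_sums_def)
qed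

lemma recip_sums_uminus:
  assumes "x \<in> recip_sums A" and "\<And>f. f \<in> A \<Longrightarrow> - f \<in> A"
  shows "- x \<in> recip_sums A"
  using assms(1)
proof (induction rule: recip_sums_induct)
  case zero
  show ?case by (simp add: recip_sums_zero)
next
  case (add f x)
  have "- (Fract 1 f + x) = Fract 1 (- f) + (- x)"
    by (metis add.commute minus_add minus_fract minus_minus minus_fract_cancel)
  then show ?case using recip_sums_add recip_sums_Fract assms(2) add by metis
qed

lemma recip_sums_mult:
  assumes "x \<in> recip_sums A" "y \<in> recip_sums B"
    and AB: "\<And>f g. f \<in> A \<Longrightarrow> g \<in> B \<Longrightarrow> f * g \<in> C"
  shows "x * y \<in> recip_sums C"
  using assms(1)
proof (induction rule: recip_sums_induct)
  case zero
  show ?case by (simp add: recip_sums_zero)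
next
  case (add f x)
  have "Fract 1 f * y \<in> recip_sums C"
    using assms(2)
  proof (induction rule: recip_sums_induct)
    case zero
    show ?case by (simp add: recip_sums_zero)
  next
    case (add g y)
    then show ?case using AB[OF \<open>f \<in> A\<close>, of g]
      by (simp add: distrib_left recip_sums_add recip_sums_Fract)
  qed
  with add show ?case by (simp add: distrib_right recip_sums_add)
qed

lemma ring_of_type_algebra_simps:
  "carrier ring_of_type_algebra = UNIV"
  "x \<oplus>\<^bsub>ring_of_type_algebra\<^esub> y = x + y"
  "x \<otimes>\<^bsub>ring_of_type_algebra\<^esub> y = x * y"
  "\<zero>\<^bsub>ring_of_type_algebra\<^esub> = 0"
  "\<one>\<^bsub>ring_of_type_algebra\<^esub> = 1"
  by (simp_all add: ring_of_type_algebra_def)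

lemma a_inv_ring_of_type_algebra:
  "\<ominus>\<^bsub>ring_of_type_algebra\<^esub> x = - (x :: 'a::comm_ring_1)"
proof -
  interpret ring "ring_of_type_algebra :: 'a ring" ..
  show ?thesis
    using minus_equality[of "- x" x] by (simp add: ring_of_type_algebra_simps)
qed

lemma reciprocal_complement_simps:
  "x \<oplus>\<^bsub>reciprocal_complement T\<^esub> y = x + y"
  "x \<otimes>\<^bsub>reciprocal_complement T\<^esub> y = x * y"
  "\<zero>\<^bsub>reciprocal_complement T\<^esub> = 0"
  "\<one>\<^bsub>reciprocal_complement T\<^esub> = 1"
  by (simp_all add: reciprocal_complement_def ring_of_type_algebra_simps)

lemma cring_reciprocal_complement: "cring (reciprocal_complement TYPE('a::idom))"
proof -
  interpret cring "ring_of_type_algebra :: 'a fract ring" ..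
  show ?thesis
    unfolding reciprocal_complement_def
    by (intro subcring_iff[THEN iffD1] subcringI' generate_ring_is_subring)
      (auto simp: ring_of_type_algebra_simps)
qed

text \<open>
  Sums of reciprocals of nonzero elements already form a ring, because products and negatives of
  reciprocals are again reciprocals.
\<close>
lemma carrier_reciprocal_complement:
  "carrier (reciprocal_complement TYPE('a::idom)) = recip_sums (- {0})" (is "?R = ?S")
proof
  have gen: "?R = generate_ring ring_of_type_algebra {Fract 1 f | f::'a. f \<noteq> 0}"
    by (simp add: reciprocal_complement_def)
  show "?R \<subseteq> ?S"
  proof
    fix x assume "x \<in> ?R"
    then show "x \<in> ?S" unfolding gen
    proof (induction rule: generate_ring.induct)
      case one
      show ?case using recip_sums_Fract[of 1 "- {0::'a}"]
        by (simp add: ring_of_type_algebra_simps One_fract_def)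
    next
      case (a_inv h)
      then show ?case by (auto simp: a_inv_ring_of_type_algebra intro: recip_sums_uminus)
    next
      case (eng_mult x y)
      then show ?case
        using recip_sums_mult[of x "- {0}" y "- {0}" "- {0}"]
        by (simp add: ring_of_type_algebra_simps)
    qed (auto simp: ring_of_type_algebra_simps recip_sums_add recip_sums_Fract)
  qed
  show "?S \<subseteq> ?R"
  proof
    interpret cring "reciprocal_complement TYPE('a)" by (rule cring_reciprocal_complement)
    fix x assume "x \<in> ?S"
    then show "x \<in> ?R"
    proof (induction rule: recip_sums_induct)
      case zero
      show ?case using zero_closed by (simp add: reciprocal_complement_simps)
    next
      case (add f x)
      have "Fract 1 f \<in> ?R" unfolding gen using add.hyps by (auto intro: generate_ring.incl)
      then show ?case using a_closed[of "Fract 1 f" x] add.IH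
        by (simp add: reciprocal_complement_simps)
    qed
  qed
qed

section \<open>Local rings\<close>

text \<open>
  A proper ideal contains no unit, so it lies inside \<open>I\<close>: thus \<open>I\<close> is the largest proper ideal.
\<close>

lemma (in cring) local_ring_if_nonunits_in_ideal:
  assumes I: "ideal I R" and one: "\<one> \<notin> I"
    and units: "\<And>x. x \<in> carrier R \<Longrightarrow> x \<notin> I \<Longrightarrow> x \<in> Units R"
  shows "local_ring R" "maximalideal I R"
proof -
  have proper: "J \<subseteq> I" if J: "ideal J R" "J \<noteq> carrier R" for J
  proof
    interpret J: ideal J R by fact
    fix x assume x: "x \<in> J"
    show "x \<in> I"
    proof (rule ccontr)
      assume "x \<notin> I"
      then have u: "x \<in> Units R" using units x J.Icarr by blast
      then have "inv x \<otimes> x \<in> J" using x J.I_l_closed by blast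
      then show False using u J.one_imp_carrier J(2) by simp
    qed
  qed
  show max: "maximalideal I R"
    using I one proper by (intro maximalidealI) (assumption, metis one_closed, blast)
  have "M = I" if M: "maximalideal M R" for M
  proof -
    interpret M: maximalideal M R by fact
    have "M \<subseteq> I" using proper[OF M.is_ideal] M.I_notcarr by auto
    then show ?thesis
      using M.I_maximal[OF I] I one by (metis ideal.Icarr one_closed subsetI)
  qed
  with max have "\<exists>!M. maximalideal M R" by blast
  then show "local_ring R"
    by (intro local_ring.intro local_ring_axioms.intro cring_axioms)
qed

section \<open>Reciprocals of nonconstant polynomials\<close>

text \<open>
  In the recursion \<open>c(M + f) = f c(M) + \<Prod>M\<close> the first summand has leading monomial
  \<open>lead f + lead (\<Prod>M)\<close>, strictly above that of the second since \<open>f\<close> is nonconstant. So no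
  cancellation of leading terms can occur.
\<close>
lemma cleared_nonconstant:
  fixes M :: "('k::field, 'n::linorder) mpoly multiset"
  assumes "\<And>f. f \<in># M \<Longrightarrow> nonconstant f"
  shows "\<exists>p. p \<noteq> 0 \<and> lead p = lead (prod_mset M) \<and> to_fract p = cleared (image_mset to_fract M)"
  using assms
proof (induction M)
  case empty
  show ?case by (intro exI[of _ 1]) (simp add: cleared_def recip_sum_def)
next
  case (add f M)
  have f: "f \<noteq> 0" "0 < lead f" using add.prems[of f] by (auto simp: nonconstant_iff_lead)
  have pM: "prod_mset M \<noteq> 0"
    using add.prems nonconstant_nonzero by (auto simp: prod_mset_zero_iff)
  obtain p where p: "p \<noteq> 0" "lead p = lead (prod_mset M)"
    "to_fract p = cleared (image_mset to_fract M)"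
    using add by auto
  have lead_fp: "lead (f * p) = lead f + lead (prod_mset M)"
    by (simp add: lead_mult f p)
  have less: "lead (prod_mset M) < lead (f * p)"
    using add_strict_right_mono[OF f(2), of "lead (prod_mset M)"] lead_fp by simp
  have "f * p \<noteq> 0" using f p by simp
  note * = lead_add_less[OF this less]
  have prod: "prod_mset (image_mset to_fract M) = to_fract (prod_mset M)" for M :: "('k, 'n) mpoly multiset"
    by (induction M) auto
  show ?case
    using * lead_fp f(1) pM
    by (intro exI[of _ "f * p + prod_mset M"])
      (simp add: cleared_add_mset p prod lead_mult)
qed

lemma one_plus_nonconstant_recip_sum:
  fixes x :: "('k::field, 'n::linorder) mpoly fract"
  assumes "x \<in> recip_sums (Collect nonconstant)"
  shows "1 + x \<noteq> 0" "inverse (1 + x) \<in> recip_sums (- {0})"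
proof -
  obtain M :: "('k, 'n) mpoly multiset" where M: "\<And>f. f \<in># M \<Longrightarrow> nonconstant f"
    and x: "x = recip_sum (image_mset to_fract M)"
    using assms by (auto simp: recip_sums_def)
  show "1 + x \<noteq> 0"
    using cleared_nonconstant[of M] M x by (auto simp: cleared_def)
  show "inverse (1 + x) \<in> recip_sums (- {0})"
    unfolding x
  proof (rule inverse_one_plus_recip_sum_mem)
    fix a b :: "('k, 'n) mpoly fract"
    assume ab: "a \<in> recip_sums (- {0})" "b \<in> recip_sums (- {0})"
    show "a - b \<in> recip_sums (- {0})"
      using recip_sums_add[OF ab(1) recip_sums_uminus[OF ab(2)]] by simp
    show "a * b \<in> recip_sums (- {0})" using recip_sums_mult[OF ab] by simp
  next
    show "0 \<notin># image_mset to_fract M" using M[of 0] nonconstant_nonzero[of 0] by auto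
  next
    fix N :: "('k, 'n) mpoly fract multiset"
    assume "N \<subseteq># image_mset to_fract M"
    then obtain M' where "M' \<subseteq># M" and N: "N = image_mset to_fract M'"
      by (metis image_mset_eq_plusD mset_subset_eq_exists_conv mset_subset_eq_add_left)
    then have "\<And>f. f \<in># M' \<Longrightarrow> nonconstant f" using M by (meson mset_subset_eqD)
    from cleared_nonconstant[OF this] obtain p where "p \<noteq> 0" "to_fract p = cleared N"
      unfolding N by auto
    then show "cleared N \<noteq> 0 \<and> inverse (cleared N) \<in> recip_sums (- {0})"
      by (metis ComplI inverse_to_fract recip_sums_Fract singletonD to_fract_eq_0_iff)
  qed
qed

text \<open>
  The reciprocal of a nonzero constant is again a constant, so the constant denominators of a sum
  can be collected in one constant.
\<close>
lemma constant_plus_nonconstant_recip_sum: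
  fixes x :: "('k::field, 'n::linorder) mpoly fract"
  assumes "x \<in> recip_sums (- {0})"
  obtains c y where "x = to_fract (Poly_Mapping.single 0 c) + y" "y \<in> recip_sums (Collect nonconstant)"
proof -
  have "\<exists>c. \<exists>y\<in>recip_sums (Collect nonconstant). x = to_fract (Poly_Mapping.single 0 c) + y"
    using assms
  proof (induction rule: recip_sums_induct)
    case zero
    show ?case by (intro exI[of _ 0] bexI[of _ 0]) (simp_all add: recip_sums_zero)
  next
    case (add f x)
    then obtain c y where x: "x = to_fract (Poly_Mapping.single 0 c) + y"
      and y: "y \<in> recip_sums (Collect nonconstant)" by blast
    show ?case
    proof (cases "nonconstant f")
      case True
      then have "Fract 1 f + y \<in> recip_sums (Collect nonconstant)"
        using y by (simp add: recip_sums_add recip_sums_Fract)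
      then show ?thesis using x by (intro exI[of _ c] bexI[of _ "Fract 1 f + y"]) auto
    next
      case False
      then obtain d where f: "f = Poly_Mapping.single 0 d" by (auto simp: nonconstant_def)
      with add.hyps have "d \<noteq> 0" by auto
      then have "Fract 1 f = to_fract (Poly_Mapping.single 0 (inverse d))"
        using add.hyps unfolding to_fract_def
        by (subst eq_fract) (auto simp: f mult_single)
      then have "Fract 1 f + x = to_fract (Poly_Mapping.single 0 (inverse d + c)) + y"
        using x by (simp add: single_add)
      then show ?thesis using y by blast
    qed
  qed
  then show ?thesis using that by blast
qed

theorem theorem3p3:
  fixes R :: "('k::field, 'n::{finite, linorder}) mpoly fract ring"
  assumes "R = reciprocal_complement TYPE(('k, 'n) mpoly)"
  shows "local_ring R \<and>
    maximalideal (Idl\<^bsub>R\<^esub> {Fract 1 f | f :: ('k, 'n) mpoly. nonconstant f}) R"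
proof -
  let ?G = "{Fract 1 f | f :: ('k, 'n) mpoly. nonconstant f}"
  define m where "m = recip_sums (Collect (nonconstant :: ('k, 'n) mpoly \<Rightarrow> bool))"
  interpret cring R unfolding assms by (rule cring_reciprocal_complement)
  have carrier: "carrier R = recip_sums (- {0})"
    unfolding assms by (rule carrier_reciprocal_complement)
  note simps = reciprocal_complement_simps[of "TYPE(('k, 'n) mpoly)", folded assms]
  have G: "?G \<subseteq> carrier R"
    using nonconstant_nonzero by (auto simp: carrier intro!: recip_sums_Fract)
  interpret J: ideal "Idl\<^bsub>R\<^esub> ?G" R by (rule genideal_ideal[OF G])
  have m_sub: "m \<subseteq> Idl\<^bsub>R\<^esub> ?G"
  proof
    fix x assume "x \<in> m"
    then show "x \<in> Idl\<^bsub>R\<^esub> ?G" unfolding m_def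
    proof (induction rule: recip_sums_induct)
      case zero
      show ?case using J.zero_closed by (simp add: simps)
    next
      case (add f x)
      then have "Fract 1 f \<in> Idl\<^bsub>R\<^esub> ?G" using genideal_self[OF G] by auto
      then show ?case using J.a_closed[of "Fract 1 f" x] add.IH by (simp add: simps)
    qed
  qed
  have m_carrier: "m \<subseteq> carrier R" using m_sub J.Icarr by auto
  have m_absorbs: "r * x \<in> m" if "x \<in> m" "r \<in> carrier R" for r x
    using that recip_sums_mult[of r "- {0}" x "Collect nonconstant" "Collect nonconstant"]
    by (auto simp: m_def carrier nonconstant_mult)
  have "ideal m R"
  proof (rule idealI[OF ring_axioms])
    show "subgroup m (add_monoid R)"
    proof (rule add.subgroupI)
      show "m \<noteq> {}" using recip_sums_zero m_def by blast
      show "\<ominus>\<^bsub>R\<^esub> x \<in> m" if x: "x \<in> m" for x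
      proof -
        have "- x \<in> m" using x by (auto simp: m_def nonconstant_uminus intro: recip_sums_uminus)
        then have "\<ominus>\<^bsub>R\<^esub> x = - x"
          using x m_carrier by (intro minus_equality) (auto simp: simps)
        with \<open>- x \<in> m\<close> show ?thesis by simp
      qed
    qed (use m_carrier in \<open>auto simp: simps m_def recip_sums_add\<close>)
  qed (use m_absorbs in \<open>auto simp: simps mult.commute\<close>)
  moreover have "?G \<subseteq> m" by (auto simp: m_def recip_sums_Fract)
  ultimately have J_eq: "Idl\<^bsub>R\<^esub> ?G = m"
    using m_sub genideal_minimal by blast
  \<comment> \<open>If \<open>1\<close> were in \<open>m\<close>, so would be \<open>-1\<close>, and \<open>1 + (-1)\<close> would be nonzero.\<close>
  have "1 \<notin> m"
  proof
    assume "1 \<in> m"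
    then have "- 1 \<in> m" by (auto simp: m_def nonconstant_uminus intro: recip_sums_uminus)
    then show False using one_plus_nonconstant_recip_sum(1)[of "- 1"] by (simp add: m_def)
  qed
  moreover have "x \<in> Units R" if x: "x \<in> carrier R" "x \<notin> m" for x
  proof -
    obtain c y where xy: "x = to_fract (Poly_Mapping.single 0 c) + y" and y: "y \<in> m"
      using x constant_plus_nonconstant_recip_sum by (metis carrier m_def)
    have "c \<noteq> 0" using xy y x(2) by auto
    let ?k = "Poly_Mapping.single 0 c :: ('k, 'n) mpoly"
    have k: "?k \<noteq> 0" using \<open>c \<noteq> 0\<close> by (metis lookup_single_eq lookup_zero)
    then have ik: "inverse (to_fract ?k) \<in> carrier R"
      by (simp add: inverse_to_fract carrier recip_sums_Fract)
    define z where "z = inverse (to_fract ?k) * y"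
    have "z \<in> m" using m_absorbs[OF y ik] by (simp add: z_def)
    then have z: "1 + z \<noteq> 0" "inverse (1 + z) \<in> carrier R"
      using one_plus_nonconstant_recip_sum[of z] by (simp_all add: m_def carrier)
    have xz: "x = to_fract ?k * (1 + z)" using k by (simp add: xy z_def algebra_simps)
    have "inverse x \<in> carrier R"
      using m_closed[OF ik z(2)] by (simp add: xz simps)
    moreover have "x \<noteq> 0" using xz k z(1) by simp
    ultimately show ?thesis using x(1) by (auto simp: Units_def simps intro!: bexI[of _ "inverse x"])
  qed
  ultimately show ?thesis
    using local_ring_if_nonunits_in_ideal[of m] \<open>ideal m R\<close> by (simp add: J_eq simps)
qed

end
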